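(* Let $\mathcal{K}\subset\mathbb{R}^m$ be a proper convex cone whose dual cone $\mathcal{K}^*$ admits a $\nu$-LHSCB $f:(\mathcal{K}^* )^\circ\to\mathbb{R}$ with gradient $g$ and Hessian $H$, and let $B(y)=H(y)+g(y)g(y)^{\mathrm T}$. Let $b\in\mathcal{K}^\circ$, and define $$\mathcal{B}(b)=\{y\in(\mathcal{K}^* )^\circ : B(y)^{-1}b\in\mathcal{K}^*\},\qquad \mathcal{H}(b)=\{y\in(\mathcal{K}^* )^\circ : H(y)^{-1}b\in\mathcal{K}^*\}.$$ Let $y_b$ be the unique vector in $(\mathcal{K}^* )^\circ$ satisfying $-g(y_b)=b$. Then $\mathcal{B}(b)$ and $\mathcal{H}(b)$ are full-dimensional subcones of $(\mathcal{K}^* )^\circ$ containing $y_b$.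
   Context: A proper convex cone is a closed convex cone that is pointed and has non-empty interior. $\mathcal{C}^\circ$ denotes the interior of $\mathcal{C}$. The dual cone is $\mathcal{K}^*=\{y\in\mathbb{R}^m : x^{\mathrm T}y\ge 0 \text{ for all } x\in\mathcal{K}\}$. Here "subcone" means a subset closed under multiplication by positive scalars (convexity is not asserted), and "full-dimensional" means having non-empty interior. A (strongly nondegenerate) self-concordant barrier (SCB) for a convex cone $\mathcal{C}$ with non-empty interior is a strictly convex, at least three times differentiable function $f:\mathcal{C}^\circ\to\mathbb{R}$ with positive definite Hessian everywhere such that, with $g$ and $H$ denoting the gradient and Hessian of $f$: (1) $f(x)\to\infty$ as $x$ tends to the boundary of $\mathcal{C}$; (2) $|D^3f(x)[h,h,h]|\le 2\,(D^2f(x)[h,h])^{3/2}$ for all $x\in\mathcal{C}^\circ$ and all directions $h$; (3) $\nu:=\sup_{x\in\mathcal{C}^\circ} g(x)^{\mathrm T}H(x)^{-1}g(x)<\infty$. It is a $\nu$-LHSCB (logarithmically homogeneous self-concordant barrier with parameter $\nu$) if in addition $f(tx)=f(x)-\nu\ln t$ for all $x\in\mathcal{C}^\circ$, $t>0$. It is a known fact that the gradient map $g$ is a bijection from $(\mathcal{K}^* )^\circ$ onto $-\mathcal{K}^\circ$, so $y_b$ is well defined. *)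

theory Defs
  imports "HOL-Analysis.Analysis"
begin

definition pointed :: "'a::real_vector set \<Rightarrow> bool" where
  "pointed K \<longleftrightarrow> K \<inter> uminus ` K = {0}"

definition proper_convex_cone :: "'a::euclidean_space set \<Rightarrow> bool" where
  "proper_convex_cone K \<longleftrightarrow> convex_cone K \<and> closed K \<and> pointed K \<and> interior K \<noteq> {}"

definition dual_cone :: "'a::euclidean_space set \<Rightarrow> 'a set" where
  "dual_cone K = {y. \<forall>x\<in>K. 0 \<le> x \<bullet> y}"

text \<open>A subcone need not be convex or contain 0; full-dimensional means non-empty interior.\<close>

definition full_dim_subcone :: "'a::euclidean_space set \<Rightarrow> 'a set \<Rightarrow> bool" where
  "full_dim_subcone A S \<longleftrightarrow>
     A \<subseteq> S \<and> (\<forall>x\<in>A. \<forall>t>0. t *\<^sub>R x \<in> A) \<and> interior A \<noteq> {}"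

definition gradient :: "(real^'n \<Rightarrow> real) \<Rightarrow> real^'n \<Rightarrow> real^'n" where
  "gradient f x = (THE D. GDERIV f x :> D)"

definition hessian :: "(real^'n \<Rightarrow> real) \<Rightarrow> real^'n \<Rightarrow> real^'n^'n" where
  "hessian f x = jacobian (gradient f) (at x)"

text \<open>The diagonal third derivative $D^3 f(x)[h,h,h]$, through the derivative of the
  matrix-valued map \<open>hessian f\<close>.\<close>

definition third_derivative :: "(real^'n \<Rightarrow> real) \<Rightarrow> real^'n \<Rightarrow> real^'n \<Rightarrow> real" where
  "third_derivative f x h = h \<bullet> (frechet_derivative (hessian f) (at x) h *v h)"

definition positive_definite :: "real^'n^'n \<Rightarrow> bool" where
  "positive_definite A \<longleftrightarrow> transpose A = A \<and> (\<forall>h. h \<noteq> 0 \<longrightarrow> 0 < h \<bullet> (A *v h))"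

definition strictly_convex_on :: "'a::real_vector set \<Rightarrow> ('a \<Rightarrow> real) \<Rightarrow> bool" where
  "strictly_convex_on S f \<longleftrightarrow> convex S \<and>
     (\<forall>x\<in>S. \<forall>y\<in>S. \<forall>t. x \<noteq> y \<and> 0 < t \<and> t < 1 \<longrightarrow>
        f ((1 - t) *\<^sub>R x + t *\<^sub>R y) < (1 - t) * f x + t * f y)"

text \<open>Barriers live on the interior of the cone; they are represented by total functions whose
  values outside the (open) interior are irrelevant.\<close>

definition newton_decrement_sq :: "(real^'n \<Rightarrow> real) \<Rightarrow> real^'n \<Rightarrow> real" where
  "newton_decrement_sq f x = gradient f x \<bullet> (matrix_inv (hessian f x) *v gradient f x)"

definition is_SCB :: "(real^'n) set \<Rightarrow> (real^'n \<Rightarrow> real) \<Rightarrow> bool" where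
  "is_SCB C f \<longleftrightarrow>
     convex_cone C \<and> interior C \<noteq> {} \<and>
     strictly_convex_on (interior C) f \<and>
     f differentiable_on interior C \<and>
     gradient f differentiable_on interior C \<and>
     hessian f differentiable_on interior C \<and>
     (\<forall>x\<in>interior C. positive_definite (hessian f x)) \<and>
     (\<forall>z\<in>frontier C. filterlim f at_top (at z within interior C)) \<and>
     (\<forall>x\<in>interior C. \<forall>h.
        \<bar>third_derivative f x h\<bar> \<le> 2 * (h \<bullet> (hessian f x *v h)) powr (3/2)) \<and>
     bdd_above (newton_decrement_sq f ` interior C)"

definition barrier_parameter :: "(real^'n) set \<Rightarrow> (real^'n \<Rightarrow> real) \<Rightarrow> real" where
  "barrier_parameter C f = (SUP x\<in>interior C. newton_decrement_sq f x)"

definition is_LHSCB :: "real \<Rightarrow> (real^'n) set \<Rightarrow> (real^'n \<Rightarrow> real) \<Rightarrow> bool" where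
  "is_LHSCB \<nu> C f \<longleftrightarrow>
     is_SCB C f \<and> barrier_parameter C f = \<nu> \<and>
     (\<forall>x\<in>interior C. \<forall>t>0. f (t *\<^sub>R x) = f x - \<nu> * ln t)"

definition B_matrix :: "(real^'n \<Rightarrow> real) \<Rightarrow> real^'n \<Rightarrow> real^'n^'n" where
  "B_matrix f y = hessian f y + (\<chi> i j. gradient f y $ i * gradient f y $ j)"

definition B_cone :: "(real^'n) set \<Rightarrow> (real^'n \<Rightarrow> real) \<Rightarrow> real^'n \<Rightarrow> (real^'n) set" where
  "B_cone K f b =
     {y \<in> interior (dual_cone K). matrix_inv (B_matrix f y) *v b \<in> dual_cone K}"

definition H_cone :: "(real^'n) set \<Rightarrow> (real^'n \<Rightarrow> real) \<Rightarrow> real^'n \<Rightarrow> (real^'n) set" where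
  "H_cone K f b =
     {y \<in> interior (dual_cone K). matrix_inv (hessian f y) *v b \<in> dual_cone K}"

end

theory Submission
  imports Defs
begin

text \<open>
  Differentiating $f(ty) = f(y) - \nu \ln t$ gives $g(ty) = g(y)/t$, $H(ty) = H(y)/t^2$,
  $g(y)^T y = -\nu$ and $H(y)y = -g(y)$, hence $B(y)y = -(1+\nu) g(y)$. At $y_b$ this reads
  $H(y_b)^{-1}b = y_b$ and $B(y_b)^{-1}b = y_b/(1+\nu)$, both interior to the dual cone; by continuity
  of the two maps $y_b$ is an interior point of both sets. A point with $-g(y) = b$ is
  a minimiser of $f$ on the bounded slice $b^T y = \nu$: the multiplier is forced to be $-1$ by
  $g(y)^T y = -\nu$. It is unique because $g$ is strictly monotone along segments.
\<close>

section \<open>Gradient and Hessian as Frechet derivatives\<close>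

lemma gderiv_gradient:
  fixes f :: "real^'n \<Rightarrow> real"
  assumes "f differentiable (at x)"
  shows "GDERIV f x :> gradient f x"
proof -
  obtain L where L: "(f has_derivative L) (at x)"
    using assms by (auto simp: differentiable_def)
  have lin: "linear L" using L by (rule has_derivative_linear)
  \<comment> \<open>Riesz representation: the adjoint of the functional \<open>L\<close>, evaluated
    at 1, is the vector that represents it. This is the witness for the definite description in
    \<open>gradient\<close>.\<close>
  have "L = (\<lambda>h. h \<bullet> adjoint L 1)"
    using adjoint_works[OF lin, of _ 1] by auto
  then have ex: "GDERIV f x :> adjoint L 1"
    using L by (simp add: gderiv_def)
  have uniq: "D = adjoint L 1" if "GDERIV f x :> D" for D
  proof -
    have "(\<lambda>h. h \<bullet> D) = (\<lambda>h. h \<bullet> adjoint L 1)"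
      using that ex unfolding gderiv_def by (rule has_derivative_unique)
    then have "h \<bullet> D = h \<bullet> adjoint L 1" for h
      by (rule fun_cong)
    then show ?thesis
      using vector_eq_ldot by blast
  qed
  show ?thesis
    unfolding gradient_def using ex uniq by (rule theI)
qed

lemma has_derivative_gradient:
  fixes f :: "real^'n \<Rightarrow> real"
  assumes "gradient f differentiable (at x)"
  shows "(gradient f has_derivative (\<lambda>h. hessian f x *v h)) (at x)"
  using assms unfolding hessian_def by (simp add: jacobian_works)

section \<open>Positive definiteness and rank-one updates\<close>

lemma matrix_vector_mult_outer_product:
  fixes u h :: "real^'n"
  shows "(\<chi> i j. u $ i * u $ j) *v h = (u \<bullet> h) *\<^sub>R u"
  by (simp add: vec_eq_iff matrix_vector_mult_def inner_vec_def sum_distrib_right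
      sum_distrib_left mult_ac)

lemma positive_definite_imp_invertible:
  fixes A :: "real^'n^'n"
  assumes "positive_definite A"
  shows "invertible A"
proof -
  have "x = 0" if "A *v x = 0" for x
    using assms that unfolding positive_definite_def by force
  then show ?thesis
    by (simp add: invertible_left_inverse matrix_left_invertible_ker)
qed

text \<open>The rank-one term adds the square of \<open>u \<bullet> h\<close> to the quadratic form.
  With \<open>u\<close> the gradient this makes \<open>B_matrix\<close> positive definite, hence
  invertible.\<close>

lemma positive_definite_add_outer_product:
  fixes A :: "real^'n^'n"
  assumes "positive_definite A"
  shows "positive_definite (A + (\<chi> i j. u $ i * u $ j))"
  unfolding positive_definite_def
proof safe
  have "A $ j $ i = A $ i $ j" for i j
    using assms unfolding positive_definite_def transpose_def by (metis vec_lambda_beta)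
  then show "transpose (A + (\<chi> i j. u $ i * u $ j)) = A + (\<chi> i j. u $ i * u $ j)"
    by (simp add: transpose_def vec_eq_iff mult.commute)
next
  fix h :: "real^'n" assume "h \<noteq> 0"
  then have "0 < h \<bullet> (A *v h)"
    using assms by (auto simp: positive_definite_def)
  moreover have "0 \<le> h \<bullet> ((u \<bullet> h) *\<^sub>R u)"
    by (simp add: inner_commute)
  ultimately show "0 < h \<bullet> ((A + (\<chi> i j. u $ i * u $ j)) *v h)"
    by (simp add: matrix_vector_mult_add_rdistrib matrix_vector_mult_outer_product inner_add_right)
qed

section \<open>Inverse matrices: continuity and scaling\<close>

lemma matrix_inv_inverse:
  fixes A :: "real^'n^'n"
  assumes "invertible A"
  shows "A ** matrix_inv A = mat 1" "matrix_inv A ** A = mat 1"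
  using someI_ex[OF assms[unfolded invertible_def]] by (simp_all add: matrix_inv_def)

lemma matrix_inv_mult_eqI:
  fixes A :: "real^'n^'n"
  assumes "invertible A" "A *v x = c"
  shows "matrix_inv A *v c = x"
  using matrix_inv_inverse(2)[OF assms(1)] assms(2)
  by (metis matrix_vector_mul_assoc matrix_vector_mul_lid)

lemma tendsto_det:
  fixes A :: "'a \<Rightarrow> real^'n^'n"
  assumes "\<And>i j. ((\<lambda>x. A x $ i $ j) \<longlongrightarrow> L $ i $ j) F"
  shows "((\<lambda>x. det (A x)) \<longlongrightarrow> det L) F"
  unfolding det_def by (intro tendsto_intros assms)

lemma tendsto_matrix_inv_mult:
  fixes A :: "'a \<Rightarrow> real^'n^'n"
  assumes lim: "(A \<longlongrightarrow> L) F" and L: "invertible L"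
    and A: "\<forall>\<^sub>F x in F. invertible (A x)"
  shows "((\<lambda>x. matrix_inv (A x) *v c) \<longlongrightarrow> matrix_inv L *v c) F"
proof -
  \<comment> \<open>Cramer's rule, which makes the continuity in the matrix entries evident\<close>
  define sol where
    "sol M = (\<chi> k. det (\<chi> i j. if j = k then c $ i else M $ i $ j) / det M)" for M :: "real^'n^'n"
  have sol: "matrix_inv M *v c = sol M" if "invertible M" for M :: "real^'n^'n"
    using that unfolding sol_def
    by (intro matrix_inv_mult_eqI) (auto simp: cramer invertible_det_nz)
  have ent: "((\<lambda>x. A x $ i $ j) \<longlongrightarrow> L $ i $ j) F" for i j
    by (intro tendsto_vec_nth lim)
  have "((\<lambda>x. sol (A x)) \<longlongrightarrow> sol L) F"
    unfolding sol_def using L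
    by (intro tendsto_vec_lambda tendsto_divide tendsto_det)
       (auto simp: invertible_det_nz intro: ent)
  moreover have "\<forall>\<^sub>F x in F. sol (A x) = matrix_inv (A x) *v c"
    using A by eventually_elim (simp add: sol)
  ultimately show ?thesis
    using L by (simp add: sol) (rule Lim_transform_eventually)
qed

text \<open>The preimage of \<open>interior C\<close> under a continuous map on the open set
  \<open>S\<close> is open and lies inside the set in question. Keeping \<open>A\<close> arbitrary
  covers both \<open>hessian f\<close> and \<open>B_matrix f\<close>.\<close>

lemma interior_matrix_inv_preimage:
  fixes A :: "real^'n \<Rightarrow> real^'n^'n"
  assumes "open S" "continuous_on S A" "\<And>x. x \<in> S \<Longrightarrow> invertible (A x)"
    and "y \<in> S" "matrix_inv (A y) *v c \<in> interior C"
  shows "y \<in> interior {x \<in> S. matrix_inv (A x) *v c \<in> C}"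
proof -
  have "continuous_on S (\<lambda>x. matrix_inv (A x) *v c)"
    unfolding continuous_on_def
  proof
    fix x assume x: "x \<in> S"
    have "\<forall>\<^sub>F z in at x within S. invertible (A z)"
      by (simp add: eventually_at_filter assms(3))
    then show "((\<lambda>x. matrix_inv (A x) *v c) \<longlongrightarrow> matrix_inv (A x) *v c) (at x within S)"
      using x assms(2,3) by (intro tendsto_matrix_inv_mult) (auto simp: continuous_on_def)
  qed
  then have "open (S \<inter> (\<lambda>x. matrix_inv (A x) *v c) -` interior C)"
    using \<open>open S\<close> by (rule continuous_open_preimage) simp
  moreover have "S \<inter> (\<lambda>x. matrix_inv (A x) *v c) -` interior C \<subseteq> {x \<in> S. matrix_inv (A x) *v c \<in> C}"
    using interior_subset by auto
  ultimately show ?thesis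
    using assms(4,5) by (meson IntI interiorI vimageI)
qed

lemma matrix_inv_scaleR_mult:
  fixes A :: "real^'n^'n"
  assumes "invertible A" "t \<noteq> 0"
  shows "matrix_inv (t *\<^sub>R A) *v c = inverse t *\<^sub>R (matrix_inv A *v c)"
proof (rule matrix_inv_mult_eqI)
  show "invertible (t *\<^sub>R A)"
    using assms by (simp add: scalar_invertible)
  show "(t *\<^sub>R A) *v (inverse t *\<^sub>R (matrix_inv A *v c)) = c"
    using assms matrix_inv_inverse(1)[OF assms(1)]
    by (simp add: scaleR_matrix_vector_assoc[symmetric] matrix_vector_mult_scaleR)
       (simp add: matrix_vector_mul_assoc)
qed

section \<open>Calculus of logarithmically homogeneous functions\<close>

lemma has_derivative_dilation:
  assumes "(g has_derivative g') (at (t *\<^sub>R y))"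
  shows "((\<lambda>z. g (t *\<^sub>R z)) has_derivative (\<lambda>h. g' (t *\<^sub>R h))) (at y)"
  by (rule has_derivative_compose[OF has_derivative_scaleR_right[OF has_derivative_ident] assms])

text \<open>Chain rule along a line, used on rays (\<open>x = 0\<close>), on segments, and along
  directions inside a hyperplane.\<close>

lemma has_derivative_along_line:
  assumes "(g has_derivative g') (at (x + t *\<^sub>R h))"
  shows "((\<lambda>t. g (x + t *\<^sub>R h)) has_derivative (\<lambda>s. g' (s *\<^sub>R h))) (at t)"
proof -
  have "((\<lambda>t. x + t *\<^sub>R h) has_derivative (\<lambda>s. s *\<^sub>R h)) (at t)"
    by (auto intro!: derivative_eq_intros)
  from has_derivative_compose[OF this assms] show ?thesis .
qed

text \<open>The setting for the Euler-type identities; the theorem instantiates \<open>S\<close>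
  with the interior of the dual cone.\<close>

locale log_homogeneous =
  fixes S :: "(real^'n) set" and f :: "real^'n \<Rightarrow> real" and \<nu> :: real
  assumes open_S: "open S"
    and scale: "\<And>y t. y \<in> S \<Longrightarrow> 0 < t \<Longrightarrow> t *\<^sub>R y \<in> S"
    and diff: "f differentiable_on S"
    and diff_gradient: "gradient f differentiable_on S"
    and log_hom: "\<And>y t. y \<in> S \<Longrightarrow> 0 < t \<Longrightarrow> f (t *\<^sub>R y) = f y - \<nu> * ln t"
begin

lemma f_deriv: "y \<in> S \<Longrightarrow> (f has_derivative (\<lambda>h. h \<bullet> gradient f y)) (at y)"
  using diff gderiv_gradient
  unfolding differentiable_on_eq_differentiable_at[OF open_S] gderiv_def by blast

lemma gradient_deriv: "y \<in> S \<Longrightarrow> (gradient f has_derivative (\<lambda>h. hessian f y *v h)) (at y)"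
  using diff_gradient has_derivative_gradient
  unfolding differentiable_on_eq_differentiable_at[OF open_S] by blast

text \<open>The map \<open>z\<close> to \<open>f (t *\<^sub>R z)\<close> is differentiated twice
  over: by the chain rule, and through \<open>log_hom\<close>, where the logarithmic term is
  constant in \<open>z\<close>. Uniqueness of the derivative equates the results.\<close>

lemma gradient_scaleR:
  assumes y: "y \<in> S" and t: "0 < t"
  shows "gradient f (t *\<^sub>R y) = inverse t *\<^sub>R gradient f y"
proof -
  have "((\<lambda>z. f (t *\<^sub>R z)) has_derivative (\<lambda>h. (t *\<^sub>R h) \<bullet> gradient f (t *\<^sub>R y))) (at y)"
    by (rule has_derivative_dilation[OF f_deriv[OF scale[OF y t]]])
  moreover have "((\<lambda>z. f (t *\<^sub>R z)) has_derivative (\<lambda>h. h \<bullet> gradient f y)) (at y)"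
  proof (rule has_derivative_transform_within_open[OF _ open_S y])
    show "((\<lambda>z. f z - \<nu> * ln t) has_derivative (\<lambda>h. h \<bullet> gradient f y)) (at y)"
      using f_deriv[OF y] by (auto intro!: derivative_eq_intros)
  qed (simp add: log_hom t)
  ultimately have "(\<lambda>h. (t *\<^sub>R h) \<bullet> gradient f (t *\<^sub>R y)) = (\<lambda>h. h \<bullet> gradient f y)"
    by (rule has_derivative_unique)
  then have "h \<bullet> (t *\<^sub>R gradient f (t *\<^sub>R y)) = h \<bullet> gradient f y" for h
    by (metis inner_scaleR_left inner_scaleR_right)
  then have "t *\<^sub>R gradient f (t *\<^sub>R y) = gradient f y"
    using vector_eq_ldot by blast
  then have "inverse t *\<^sub>R gradient f y = inverse t *\<^sub>R (t *\<^sub>R gradient f (t *\<^sub>R y))"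
    by simp
  then show ?thesis
    using t by simp
qed

text \<open>The same comparison one order higher: one factor \<open>inverse t\<close> comes from
  \<open>gradient_scaleR\<close>, the other from the chain rule.\<close>

lemma hessian_scaleR:
  assumes y: "y \<in> S" and t: "0 < t"
  shows "hessian f (t *\<^sub>R y) = inverse (t\<^sup>2) *\<^sub>R hessian f y"
proof -
  have "((\<lambda>z. gradient f (t *\<^sub>R z)) has_derivative (\<lambda>h. hessian f (t *\<^sub>R y) *v (t *\<^sub>R h))) (at y)"
    by (rule has_derivative_dilation[OF gradient_deriv[OF scale[OF y t]]])
  moreover have "((\<lambda>z. gradient f (t *\<^sub>R z)) has_derivative
      (\<lambda>h. inverse t *\<^sub>R (hessian f y *v h))) (at y)"
  proof (rule has_derivative_transform_within_open[OF _ open_S y])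
    show "((\<lambda>z. inverse t *\<^sub>R gradient f z) has_derivative
        (\<lambda>h. inverse t *\<^sub>R (hessian f y *v h))) (at y)"
      by (rule has_derivative_scaleR_right[OF gradient_deriv[OF y]])
  qed (simp add: gradient_scaleR t)
  ultimately have "(\<lambda>h. hessian f (t *\<^sub>R y) *v (t *\<^sub>R h)) = (\<lambda>h. inverse t *\<^sub>R (hessian f y *v h))"
    by (rule has_derivative_unique)
  then have *: "t *\<^sub>R (hessian f (t *\<^sub>R y) *v h) = inverse t *\<^sub>R (hessian f y *v h)" for h
    by (metis matrix_vector_mult_scaleR)
  have "hessian f (t *\<^sub>R y) *v h = inverse (t\<^sup>2) *\<^sub>R (hessian f y *v h)" for h
  proof -
    have "hessian f (t *\<^sub>R y) *v h = inverse t *\<^sub>R (t *\<^sub>R (hessian f (t *\<^sub>R y) *v h))"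
      using t by simp
    also have "\<dots> = inverse (t\<^sup>2) *\<^sub>R (hessian f y *v h)"
      unfolding * by (simp add: power2_eq_square)
    finally show ?thesis .
  qed
  then show ?thesis
    by (simp add: matrix_eq scaleR_matrix_vector_assoc)
qed

text \<open>Each of the two gradient factors in the rank-one term contributes
  \<open>inverse t\<close>, so that term has the same degree as the Hessian.\<close>

lemma B_matrix_scaleR:
  assumes "y \<in> S" "0 < t"
  shows "B_matrix f (t *\<^sub>R y) = inverse (t\<^sup>2) *\<^sub>R B_matrix f y"
  using assms
  by (simp add: B_matrix_def hessian_scaleR gradient_scaleR vec_eq_iff power2_eq_square algebra_simps)

text \<open>Euler's identity, from differentiating \<open>f\<close> along the ray through
  \<open>y\<close> at \<open>t = 1\<close>.\<close>

lemma gradient_inner_self: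
  assumes y: "y \<in> S"
  shows "gradient f y \<bullet> y = - \<nu>"
proof -
  \<comment> \<open>Homogeneity is available for positive \<open>t\<close> only, so the two
    functions of \<open>t\<close> are compared on this open half-line.\<close>
  have pos: "(1::real) \<in> {0<..}" by simp
  have "((\<lambda>t. f (t *\<^sub>R y)) has_derivative (\<lambda>t. (t *\<^sub>R y) \<bullet> gradient f (1 *\<^sub>R y))) (at (1::real))"
    using has_derivative_along_line[OF f_deriv, of 0 1 y] y by simp
  moreover have "((\<lambda>t. f (t *\<^sub>R y)) has_derivative (\<lambda>t. t * (- \<nu>))) (at (1::real))"
  proof (rule has_derivative_transform_within_open[OF _ open_greaterThan pos])
    show "((\<lambda>t. f y - \<nu> * ln t) has_derivative (\<lambda>t. t * (- \<nu>))) (at (1::real))"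
      by (auto intro!: derivative_eq_intros)
  qed (simp add: log_hom y)
  ultimately have "(\<lambda>t. (t *\<^sub>R y) \<bullet> gradient f (1 *\<^sub>R y)) = (\<lambda>t. t * (- \<nu>))"
    by (rule has_derivative_unique)
  from fun_cong[OF this, of 1] show ?thesis
    by (simp add: inner_commute)
qed

lemma hessian_mult_self:
  assumes y: "y \<in> S"
  shows "hessian f y *v y = - gradient f y"
proof -
  have pos: "(1::real) \<in> {0<..}" by simp
  have "((\<lambda>t. gradient f (t *\<^sub>R y)) has_derivative (\<lambda>t. hessian f (1 *\<^sub>R y) *v (t *\<^sub>R y))) (at (1::real))"
    using has_derivative_along_line[OF gradient_deriv, of 0 1 y] y by simp
  moreover have "((\<lambda>t. gradient f (t *\<^sub>R y)) has_derivative (\<lambda>t. (- t) *\<^sub>R gradient f y)) (at (1::real))"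
  proof (rule has_derivative_transform_within_open[OF _ open_greaterThan pos])
    show "((\<lambda>t. inverse t *\<^sub>R gradient f y) has_derivative (\<lambda>t. (- t) *\<^sub>R gradient f y)) (at (1::real))"
      by (auto intro!: derivative_eq_intros)
  qed (simp add: gradient_scaleR y)
  ultimately have "(\<lambda>t. hessian f (1 *\<^sub>R y) *v (t *\<^sub>R y)) = (\<lambda>t. (- t) *\<^sub>R gradient f y)"
    by (rule has_derivative_unique)
  from fun_cong[OF this, of 1] show ?thesis
    by simp
qed

text \<open>The Hessian contributes the negative gradient once, and the rank-one term contributes it
  \<open>\<nu>\<close> times by Euler's identity.\<close>

lemma B_matrix_mult_self:
  assumes "y \<in> S"
  shows "B_matrix f y *v y = (1 + \<nu>) *\<^sub>R (- gradient f y)"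
  using assms
  by (simp add: B_matrix_def matrix_vector_mult_add_rdistrib matrix_vector_mult_outer_product
      hessian_mult_self gradient_inner_self scaleR_add_left)

text \<open>Equal gradients at two points give \<open>f\<close> equal slopes at both ends of the
  segment. The mean value theorem then yields a point where the Hessian form vanishes in the
  direction of the segment, against positive definiteness.\<close>

lemma gradient_inj_on:
  assumes "convex S" and pd: "\<And>y. y \<in> S \<Longrightarrow> positive_definite (hessian f y)"
  shows "inj_on (gradient f) S"
proof (rule inj_onI, rule ccontr)
  fix x y assume xy: "x \<in> S" "y \<in> S" "gradient f x = gradient f y" "x \<noteq> y"
  define h where "h = y - x"
  \<comment> \<open>The slope of \<open>f\<close> along the segment from \<open>x\<close> to
    \<open>y\<close>.\<close>
  define p where "p t = h \<bullet> gradient f (x + t *\<^sub>R h)" for t :: real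
  have mem: "x + t *\<^sub>R h \<in> S" if "0 \<le> t" "t \<le> 1" for t
    using convexD_alt[OF \<open>convex S\<close> xy(1,2) that] by (simp add: h_def algebra_simps)
  have deriv: "(p has_derivative (\<lambda>s. h \<bullet> (hessian f (x + t *\<^sub>R h) *v (s *\<^sub>R h)))) (at t)"
    if "0 \<le> t" "t \<le> 1" for t
    unfolding p_def
    by (rule has_derivative_inner_right[OF has_derivative_along_line[OF gradient_deriv[OF mem[OF that]]]])
  have "continuous_on {0..1} p"
    by (meson atLeastAtMost_iff continuous_at_imp_continuous_on deriv has_derivative_continuous)
  then obtain z where z: "0 < z" "z < 1"
    and "p 1 - p 0 = h \<bullet> (hessian f (x + z *\<^sub>R h) *v ((1 - 0) *\<^sub>R h))"
    by (rule mvt[OF zero_less_one _ deriv]) auto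
  then have "h \<bullet> (hessian f (x + z *\<^sub>R h) *v h) = 0"
    using xy(3) by (simp add: p_def h_def)
  then show False
    using pd[OF mem, of z] z xy(4) unfolding positive_definite_def h_def
    by (metis less_eq_real_def less_irrefl right_minus_eq)
qed

end

section \<open>Dual cones and their interiors\<close>

lemma dual_cone_scaleR: "y \<in> dual_cone K \<Longrightarrow> 0 \<le> t \<Longrightarrow> t *\<^sub>R y \<in> dual_cone K"
  by (simp add: dual_cone_def)

lemma closed_dual_cone: "closed (dual_cone K)"
proof -
  have "dual_cone K = (\<Inter>x\<in>K. {y. 0 \<le> x \<bullet> y})"
    by (auto simp: dual_cone_def)
  then show ?thesis
    by (auto intro!: closed_INT closed_halfspace_ge simp: inner_commute)
qed

lemma interior_scaleR:
  fixes C :: "'a::real_normed_vector set"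
  assumes "\<And>y. y \<in> C \<Longrightarrow> t *\<^sub>R y \<in> C" "t \<noteq> 0" "y \<in> interior C"
  shows "t *\<^sub>R y \<in> interior C"
proof (rule interiorI)
  show "open ((*\<^sub>R) t ` interior C)"
    using assms(2) by (intro open_scaling) auto
qed (use assms(1,3) interior_subset in auto)

lemma inner_sgn_self: "x \<bullet> sgn x = norm x"
  by (cases "x = 0") (simp_all add: sgn_div_norm dot_square_norm power2_eq_square)

text \<open>An interior \<open>b\<close> can be moved a fixed distance \<open>e\<close> against the
  direction of \<open>y\<close> without leaving \<open>K\<close>, so its pairing with
  \<open>y\<close> has room to spare. This bounds the slices of the dual cone.\<close>

lemma dual_cone_inner_ge:
  assumes "b \<in> interior K"
  obtains e where "0 < e" "\<And>y. y \<in> dual_cone K \<Longrightarrow> e * norm y \<le> b \<bullet> y"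
proof -
  obtain e where e: "0 < e" "cball b e \<subseteq> K"
    using assms mem_interior_cball by blast
  have "e * norm y \<le> b \<bullet> y" if "y \<in> dual_cone K" for y
  proof -
    \<comment> \<open>The displacement has norm \<open>e\<close>, or 0 when \<open>y = 0\<close>,
      since \<open>sgn 0 = 0\<close>.\<close>
    have "b - e *\<^sub>R sgn y \<in> cball b e"
      using e(1) by (simp add: dist_norm norm_sgn)
    then have "0 \<le> (b - e *\<^sub>R sgn y) \<bullet> y"
      using e(2) that unfolding dual_cone_def by blast
    then show ?thesis
      by (simp add: inner_diff_left inner_commute[of "sgn y"] inner_sgn_self)
  qed
  with e(1) that show ?thesis by blast
qed

section \<open>Constrained minimisation of a barrier\<close>

text \<open>The sublevel set of \<open>f x\<close> within the slice is compact: boundedness comes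
  from the slice, and the barrier property keeps limit points off the frontier.\<close>

lemma attains_min_on_slice:
  fixes f :: "'a::euclidean_space \<Rightarrow> real"
  assumes "closed C" and cont: "continuous_on (interior C) f"
    and barrier: "\<And>z. z \<in> frontier C \<Longrightarrow> filterlim f at_top (at z within interior C)"
    and bdd: "bounded (C \<inter> {y. b \<bullet> y = c})"
    and x: "x \<in> interior C" "b \<bullet> x = c"
  obtains y where "y \<in> interior C" "b \<bullet> y = c"
    "\<And>z. z \<in> interior C \<Longrightarrow> b \<bullet> z = c \<Longrightarrow> f y \<le> f z"
proof -
  define L where "L = {y \<in> interior C. b \<bullet> y = c \<and> f y \<le> f x}"
  have "z \<in> L" if z: "z islimpt L" for z
  proof -
    have sub: "L \<subseteq> C \<inter> {y. b \<bullet> y = c}"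
      using interior_subset by (auto simp: L_def)
    have "closed (C \<inter> {y. b \<bullet> y = c})"
      using \<open>closed C\<close> closed_hyperplane by blast
    then have zC: "z \<in> C" "b \<bullet> z = c"
      using z sub islimpt_subset closed_limpt by blast+
    have nontriv: "at z within L \<noteq> bot"
      using z trivial_limit_within by blast
    have LI: "L \<subseteq> interior C"
      by (auto simp: L_def)
    have le: "\<forall>\<^sub>F y in at z within L. f y \<le> f x"
      by (auto simp: eventually_at_filter L_def)
    have "z \<in> interior C"
    proof (rule ccontr)
      assume "z \<notin> interior C"
      then have "z \<in> frontier C"
        using zC \<open>closed C\<close> by (simp add: frontier_def)
      \<comment> \<open>At a frontier point \<open>f\<close> would exceed \<open>f x\<close> near
        \<open>z\<close>, although \<open>f\<close> is at most \<open>f x\<close> on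
        \<open>L\<close>.\<close>
      then have "filterlim f at_top (at z within L)"
        using barrier LI by (meson at_le filterlim_mono order_refl)
      then have "\<forall>\<^sub>F y in at z within L. f x < f y"
        by (simp add: filterlim_at_top_dense)
      with le have "\<forall>\<^sub>F y in at z within L. False"
        by eventually_elim simp
      with nontriv show False by simp
    qed
    then have "(f \<longlongrightarrow> f z) (at z within L)"
      using cont LI by (meson continuous_on_def tendsto_within_subset)
    then have "f z \<le> f x"
      using nontriv le by (simp add: tendsto_upperbound)
    then show ?thesis
      using \<open>z \<in> interior C\<close> zC by (simp add: L_def)
  qed
  then have "closed L"
    by (simp add: closed_limpt)
  moreover have "bounded L"
    using bdd by (rule bounded_subset) (use interior_subset in \<open>auto simp: L_def\<close>)
  ultimately have "compact L"
    by (simp add: compact_eq_bounded_closed)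
  moreover have "x \<in> L" using x by (simp add: L_def)
  moreover have "continuous_on L f"
    using cont by (rule continuous_on_subset) (auto simp: L_def)
  ultimately obtain y where "y \<in> L" "\<And>z. z \<in> L \<Longrightarrow> f y \<le> f z"
    using continuous_attains_inf[of L f] by blast
  moreover have "f y \<le> f z" if "z \<in> interior C" "b \<bullet> z = c" for z
  proof (cases "f z \<le> f x")
    case True
    then show ?thesis
      using that \<open>\<And>z. z \<in> L \<Longrightarrow> f y \<le> f z\<close> by (simp add: L_def)
  next
    case False
    then show ?thesis
      using \<open>y \<in> L\<close> by (simp add: L_def)
  qed
  ultimately show ?thesis
    by (intro that[of y]) (simp_all add: L_def)
qed

text \<open>The component of \<open>d\<close> orthogonal to \<open>b\<close> is a direction inside
  the hyperplane, so the derivative along it vanishes at the minimum; that derivative is the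
  component's squared norm.\<close>

lemma lagrange_multiplier_hyperplane:
  fixes f :: "'a::euclidean_space \<Rightarrow> real"
  assumes "open S" "y \<in> S" and deriv: "(f has_derivative (\<lambda>h. h \<bullet> d)) (at y)"
    and min: "\<And>z. z \<in> S \<Longrightarrow> b \<bullet> z = b \<bullet> y \<Longrightarrow> f y \<le> f z"
  obtains l where "d = l *\<^sub>R b"
proof -
  \<comment> \<open>The orthogonal projection of \<open>d\<close>; for \<open>b = 0\<close> it is
    \<open>d\<close> itself, and the argument still goes through.\<close>
  define h where "h = d - ((d \<bullet> b) / (b \<bullet> b)) *\<^sub>R b"
  have bh: "b \<bullet> h = 0"
    by (simp add: h_def inner_diff_right inner_commute)
  have "((\<lambda>t. f (y + t *\<^sub>R h)) has_derivative (\<lambda>t. (t *\<^sub>R h) \<bullet> d)) (at 0)"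
    by (rule has_derivative_along_line) (use deriv in simp)
  moreover have "\<forall>\<^sub>F t in at 0. f (y + 0 *\<^sub>R h) \<le> f (y + t *\<^sub>R h)"
  proof -
    have "((\<lambda>t. y + t *\<^sub>R h) \<longlongrightarrow> y + 0 *\<^sub>R h) (at 0)"
      by (intro tendsto_intros)
    then have "\<forall>\<^sub>F t in at 0. y + t *\<^sub>R h \<in> S"
      using topological_tendstoD[OF _ \<open>open S\<close>] \<open>y \<in> S\<close> by fastforce
    then show ?thesis
      by eventually_elim (simp add: min bh inner_add_right)
  qed
  ultimately have "(\<lambda>t::real. (t *\<^sub>R h) \<bullet> d) = (\<lambda>t. 0)"
    by (intro has_derivative_local_min)
  from fun_cong[OF this, of 1] have "h \<bullet> d = 0"
    by simp
  then have "h \<bullet> h = 0"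
    using bh by (subst (2) h_def) (simp add: inner_diff_right inner_commute)
  then have "d = ((d \<bullet> b) / (b \<bullet> b)) *\<^sub>R b"
    by (simp add: h_def)
  then show ?thesis by (rule that)
qed

section \<open>Existence and uniqueness of \<open>y\<^sub>b\<close>, and its place in the two
  cones\<close>

theorem theorem2p5:
  fixes K :: "(real^'m) set" and f :: "real^'m \<Rightarrow> real" and \<nu> :: real and b y\<^sub>b :: "real^'m"
  assumes "proper_convex_cone K"
    and "is_LHSCB \<nu> (dual_cone K) f"
    and "b \<in> interior K"
    and "y\<^sub>b = (THE y. y \<in> interior (dual_cone K) \<and> - gradient f y = b)"
  shows "(\<exists>!y. y \<in> interior (dual_cone K) \<and> - gradient f y = b)
    \<and> full_dim_subcone (B_cone K f b) (interior (dual_cone K)) \<and> y\<^sub>b \<in> B_cone K f b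
    \<and> full_dim_subcone (H_cone K f b) (interior (dual_cone K)) \<and> y\<^sub>b \<in> H_cone K f b"
proof -
  define C where "C = dual_cone K"
  define S where "S = interior C"
  note defs = assms(2)[unfolded is_LHSCB_def is_SCB_def, folded C_def, folded S_def]
  have pd: "positive_definite (hessian f y)" if "y \<in> S" for y
    using defs that by blast
  have convS: "convex S"
    using defs by (simp add: strictly_convex_on_def)
  interpret log_homogeneous S f \<nu>
  proof
    show "open S" by (simp add: S_def)
    show "t *\<^sub>R y \<in> S" if "y \<in> S" "0 < t" for y t
      using that unfolding S_def C_def by (intro interior_scaleR) (auto simp: dual_cone_scaleR)
  qed (use defs in auto)
  obtain e where e: "0 < e" "\<And>y. y \<in> C \<Longrightarrow> e * norm y \<le> b \<bullet> y"
    using dual_cone_inner_ge[OF assms(3)] C_def by metis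
  have SC: "S \<subseteq> C" by (simp add: S_def interior_subset)
  have "b \<noteq> 0"
  proof
    assume "b = 0"
    \<comment> \<open>For \<open>b = 0\<close> the bound \<open>e(2)\<close> would collapse
      \<open>C\<close> to the origin, leaving \<open>S\<close> empty.\<close>
    then have "y = 0" if "y \<in> C" for y
      using e(2)[OF that] e(1) by (simp add: mult_le_0_iff)
    then have "S \<subseteq> interior {0}"
      unfolding S_def by (intro interior_mono) blast
    then show False
      using defs by simp
  qed
  have S0: "0 \<notin> S"
  proof
    assume "0 \<in> S"
    then obtain r where r: "0 < r" "cball 0 r \<subseteq> C"
      by (auto simp: S_def mem_interior_cball)
    \<comment> \<open>This point of the ball pairs negatively with \<open>b\<close>, which
      \<open>e(2)\<close> forbids.\<close>
    then have "- (r *\<^sub>R sgn b) \<in> C"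
      by (auto intro!: subsetD[OF r(2)] simp: norm_sgn)
    then have "e * norm (- (r *\<^sub>R sgn b)) \<le> b \<bullet> (- (r *\<^sub>R sgn b))"
      by (rule e(2))
    also have "\<dots> = - r * norm b"
      by (simp add: inner_sgn_self)
    finally show False
      using e(1) r(1) \<open>b \<noteq> 0\<close> by (simp add: norm_sgn) (smt (verit) mult_pos_pos zero_less_norm_iff)
  qed
  obtain x where x: "x \<in> S" using defs by blast
  have "x \<noteq> 0" using x S0 by auto
  \<comment> \<open>Both Euler identities together write the parameter as a value of a positive
    definite form, hence its positivity.\<close>
  have "\<nu> = x \<bullet> (hessian f x *v x)"
    using gradient_inner_self[OF x] by (simp add: hessian_mult_self x inner_commute)
  then have \<nu>: "0 < \<nu>"
    using pd[OF x] \<open>x \<noteq> 0\<close> by (simp add: positive_definite_def)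
  have "0 < b \<bullet> x"
    using e(1) e(2)[of x] x SC \<open>x \<noteq> 0\<close> by (smt (verit) mult_pos_pos subsetD zero_less_norm_iff)
  \<comment> \<open>Rescaling an arbitrary interior point onto the slice shows that the slice meets
    the interior.\<close>
  define x' where "x' = (\<nu> / (b \<bullet> x)) *\<^sub>R x"
  have x': "x' \<in> interior C" "b \<bullet> x' = \<nu>"
    using scale[OF x, of "\<nu> / (b \<bullet> x)"] \<open>0 < b \<bullet> x\<close> \<nu> by (auto simp: x'_def S_def)
  have bdd: "bounded (C \<inter> {y. b \<bullet> y = \<nu>})"
    unfolding bounded_iff
    using e by (intro exI[of _ "\<nu> / e"]) (auto simp: field_simps)
  obtain y where y: "y \<in> S" "b \<bullet> y = \<nu>"
    and min: "\<And>z. z \<in> S \<Longrightarrow> b \<bullet> z = \<nu> \<Longrightarrow> f y \<le> f z"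
  proof (rule attains_min_on_slice[OF _ _ _ bdd x'])
    show "closed C" by (simp add: C_def closed_dual_cone)
    show "continuous_on (interior C) f"
      using diff differentiable_imp_continuous_on S_def by blast
    show "filterlim f at_top (at z within interior C)" if "z \<in> frontier C" for z
      using defs that by (simp add: S_def)
  qed (auto simp: S_def)
  obtain l where l: "gradient f y = l *\<^sub>R b"
    using lagrange_multiplier_hyperplane[OF open_S y(1) f_deriv[OF y(1)]] min y(2) by metis
  \<comment> \<open>Both sides equal \<open>gradient f y \<bullet> y\<close>: the left by the
    multiplier rule and the slice equation, the right by Euler's identity.\<close>
  have "l * \<nu> = - 1 * \<nu>"
    using gradient_inner_self[OF y(1)] y(2) by (simp add: l)
  then have "l = - 1"
    using \<nu> by (simp only: mult_cancel_right) simp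
  with l have gy: "- gradient f y = b" by simp
  have uniq: "\<exists>!z. z \<in> S \<and> - gradient f z = b"
    using y(1) gy inj_onD[OF gradient_inj_on[OF convS pd]] by (intro ex1I[of _ y]) auto
  have "y\<^sub>b = y"
    using the1_equality[OF uniq, of y] y(1) gy assms(4) by (simp add: S_def C_def)
  have invH: "invertible (hessian f z)" if "z \<in> S" for z
    by (rule positive_definite_imp_invertible[OF pd[OF that]])
  have invB: "invertible (B_matrix f z)" if "z \<in> S" for z
    unfolding B_matrix_def
    by (intro positive_definite_imp_invertible positive_definite_add_outer_product pd that)
  have contH: "continuous_on S (hessian f)"
    using defs differentiable_imp_continuous_on by blast
  have contg: "continuous_on S (gradient f)"
    using diff_gradient differentiable_imp_continuous_on by blast
  have contB: "continuous_on S (B_matrix f)"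
    unfolding B_matrix_def
    by (intro continuous_intros contH continuous_on_vec_lambda continuous_on_component contg)
  have Hy: "matrix_inv (hessian f y) *v b = y"
    using invH[OF y(1)] hessian_mult_self[OF y(1)] gy by (intro matrix_inv_mult_eqI) auto
  have By: "matrix_inv (B_matrix f y) *v b = inverse (1 + \<nu>) *\<^sub>R y"
    using invB[OF y(1)] B_matrix_mult_self[OF y(1)] gy \<nu>
    by (intro matrix_inv_mult_eqI) (auto simp: matrix_vector_mult_scaleR)
  have "inverse (1 + \<nu>) *\<^sub>R y \<in> S"
    using scale y(1) \<nu> by simp
  \<comment> \<open>One argument for both matrix fields. Since \<open>A\<close> has degree -2,
    passing from \<open>z\<close> to \<open>t *\<^sub>R z\<close> multiplies the vector
    \<open>matrix_inv (A z) *v b\<close> by the square of \<open>t\<close>, so it stays in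
    \<open>C\<close>. Assumption \<open>mem\<close> asks for \<open>S\<close> rather than
    \<open>C\<close> so that \<open>y\<close> becomes an interior point.\<close>
  have cone: "full_dim_subcone {z \<in> S. matrix_inv (A z) *v b \<in> C} S \<and> y \<in> {z \<in> S. matrix_inv (A z) *v b \<in> C}"
    if inv: "\<And>z. z \<in> S \<Longrightarrow> invertible (A z)" and cont: "continuous_on S A"
      and hom: "\<And>z t. z \<in> S \<Longrightarrow> 0 < t \<Longrightarrow> A (t *\<^sub>R z) = inverse (t\<^sup>2) *\<^sub>R A z"
      and mem: "matrix_inv (A y) *v b \<in> S" for A :: "real^'m \<Rightarrow> real^'m^'m"
  proof -
    have "y \<in> interior {z \<in> S. matrix_inv (A z) *v b \<in> C}"
      using mem by (intro interior_matrix_inv_preimage open_S cont inv y(1)) (auto simp: S_def)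
    moreover have "matrix_inv (A (t *\<^sub>R z)) *v b \<in> C"
      if "z \<in> S" "matrix_inv (A z) *v b \<in> C" "0 < t" for z t
      using that by (simp add: hom matrix_inv_scaleR_mult inv C_def dual_cone_scaleR)
    ultimately show ?thesis
      using interior_subset scale unfolding full_dim_subcone_def by blast
  qed
  have "full_dim_subcone (H_cone K f b) S \<and> y \<in> H_cone K f b"
    unfolding H_cone_def C_def[symmetric] S_def[symmetric]
    by (rule cone) (use invH contH hessian_scaleR Hy y in auto)
  moreover have "full_dim_subcone (B_cone K f b) S \<and> y \<in> B_cone K f b"
    unfolding B_cone_def C_def[symmetric] S_def[symmetric]
    by (rule cone) (use invB contB B_matrix_scaleR By \<open>inverse (1 + \<nu>) *\<^sub>R y \<in> S\<close> in auto)
  ultimately show ?thesis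
    using uniq \<open>y\<^sub>b = y\<close> by (simp add: S_def C_def)
qed

end
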